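(* Let $d\ge1$ and, for $\lambda\ge 1$, let $\Phi_\lambda\colon \mathrm{SE}(d)\to \mathrm{SO}(d+1)$ be the map which sends $\begin{bmatrix}\mu & b\\ \mathbf{0}_{1\times d}&1\end{bmatrix}$ to the orthogonal factor $U_\lambda$ of the polar decomposition $g_\lambda=U_\lambda H_\lambda$ of $g_\lambda=\begin{bmatrix}\mu & b/\lambda\\ \mathbf{0}_{1\times d}&1\end{bmatrix}$. Then the maps $\Phi_\lambda$ are approximated homomorphisms, that is: (i) $\Phi_\lambda(g^{-1})=(\Phi_\lambda(g))^{-1}$ for all $g\in\mathrm{SE}(d)$ and $\lambda\ge1$; (ii) for all $g_1,g_2\in\mathrm{SE}(d)$, $$\|\Phi_\lambda(g_1g_2)-\Phi_\lambda(g_1)\Phi_\lambda(g_2)\|_F=\mathcal{O}\left(\frac1{\lambda^2}\right)\quad(\lambda\to\infty),$$ where the implied constant may depend on $g_1,g_2$ but not on $\lambda$.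
   Context: Elements of the special Euclidean group $\mathrm{SE}(d)=\mathrm{SO}(d)\ltimes\mathbb{R}^d$ are identified with the matrices $\begin{bmatrix}\mu & b\\ \mathbf{0}_{1\times d}&1\end{bmatrix}$, $\mu\in\mathrm{SO}(d)$, $b\in\mathbb{R}^d$, and the group product is the matrix product. In the polar decomposition $g_\lambda=U_\lambda H_\lambda$, $U_\lambda$ is orthogonal and $H_\lambda$ is symmetric positive definite. $\|\cdot\|_F$ is the Frobenius norm. The notation $\mathcal{O}(x)$ means that $\mathcal{O}(x)/x$ is bounded for small enough $x$. *)

theory Defs
  imports "HOL-Analysis.Analysis" "HOL-Library.Landau_Symbols"
begin

text \<open>
  Matrices of size \<open>(d + 1) \<times> (d + 1)\<close> are indexed by the type \<open>'d option\<close>, where \<open>'d\<close> is the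
  index type of \<open>\<real>\<^sup>d\<close> (so \<open>d = CARD('d) \<ge> 1\<close>): the indices \<open>Some i\<close> are the first \<open>d\<close> rows and
  columns, and \<open>None\<close> is the last one.
\<close>

type_synonym 'n sqmat = "real ^ 'n ^ 'n"

definition SO :: "('n::finite) sqmat set" where
  "SO = {A. rotation_matrix A}"

definition affine_mat :: "('d::finite) sqmat \<Rightarrow> real ^ 'd \<Rightarrow> ('d option) sqmat" where
  "affine_mat \<mu> b = (\<chi> i j. case (i, j) of
      (Some k, Some l) \<Rightarrow> \<mu> $ k $ l
    | (Some k, None) \<Rightarrow> b $ k
    | (None, Some l) \<Rightarrow> 0
    | (None, None) \<Rightarrow> 1)"

definition SE :: "(('d::finite) option) sqmat set" where
  "SE = {affine_mat \<mu> b | \<mu> b. \<mu> \<in> SO}"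

definition linear_part :: "(('d::finite) option) sqmat \<Rightarrow> 'd sqmat" where
  "linear_part g = (\<chi> k l. g $ Some k $ Some l)"

definition translation_part :: "(('d::finite) option) sqmat \<Rightarrow> real ^ 'd" where
  "translation_part g = (\<chi> k. g $ Some k $ None)"

definition rescale :: "real \<Rightarrow> (('d::finite) option) sqmat \<Rightarrow> ('d option) sqmat" where
  "rescale r g = affine_mat (linear_part g) (translation_part g /\<^sub>R r)"

lemma rescale_affine_mat: "rescale r (affine_mat \<mu> b) = affine_mat \<mu> (b /\<^sub>R r)"
  by (simp add: rescale_def affine_mat_def linear_part_def translation_part_def)

definition spd_matrix :: "('n::finite) sqmat \<Rightarrow> bool" where
  "spd_matrix H \<longleftrightarrow> transpose H = H \<and> (\<forall>x. x \<noteq> 0 \<longrightarrow> x \<bullet> (H *v x) > 0)"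

definition polar_decomposition ::
    "('n::finite) sqmat \<Rightarrow> 'n sqmat \<Rightarrow> 'n sqmat \<Rightarrow> bool" where
  "polar_decomposition G U H \<longleftrightarrow> G = U ** H \<and> orthogonal_matrix U \<and> spd_matrix H"

text \<open>Meaningful for invertible \<open>G\<close>, which has exactly one polar decomposition.\<close>

definition polar_orthogonal_factor :: "('n::finite) sqmat \<Rightarrow> 'n sqmat" where
  "polar_orthogonal_factor G = (THE U. \<exists>H. polar_decomposition G U H)"

definition Phi :: "real \<Rightarrow> (('d::finite) option) sqmat \<Rightarrow> ('d option) sqmat" where
  "Phi r g = polar_orthogonal_factor (rescale r g)"

definition frobenius_norm :: "('n::finite) sqmat \<Rightarrow> real" where
  "frobenius_norm A = sqrt (\<Sum>i\<in>UNIV. \<Sum>j\<in>UNIV. (A $ i $ j)\<^sup>2)"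

lemma frobenius_norm_eq_norm: "frobenius_norm A = norm A"
  by (simp add: frobenius_norm_def norm_vec_def L2_set_def sum_nonneg)

end

theory Submission
  imports Defs
begin

text \<open>
  Write \<open>T(v)\<close> for the orthogonal polar factor of the translation by \<open>v\<close>. It is the rotation
  by the angle \<open>arctan (|v| / 2)\<close> in the plane spanned by \<open>v\<close> and the last basis vector, so it is
  explicit, and \<open>\<Phi>\<^sub>\<lambda>(\<mu>, b) = diag(\<mu>, 1) T(\<mu>\<^sup>T b / \<lambda>)\<close>. Conjugation by \<open>diag(\<mu>, 1)\<close> sends \<open>T(v)\<close>
  to \<open>T(\<mu> v)\<close>, and \<open>T(v)\<^sup>T = T(-v)\<close>, which gives (i). It also reduces (ii) to
  \<open>T(x + y) - T(x) T(y) = O((|x| + |y|)\<^sup>2)\<close>, which holds because \<open>T(v)\<close> is the identity plus a term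
  linear in \<open>v\<close> up to \<open>O(|v|\<^sup>2)\<close>.
\<close>

section \<open>Block matrices\<close>

definition outer :: "real ^ 'm \<Rightarrow> real ^ 'n \<Rightarrow> real ^ 'n ^ 'm" where
  "outer b c = (\<chi> i j. b $ i * c $ j)"

text \<open>\<open>affine_mat\<close> pins the last row to zeros and a 1, which transposes and
  orthogonal factors do not respect. This form is closed under sums, products and
  transposes.\<close>

definition block :: "('d::finite) sqmat \<Rightarrow> real ^ 'd \<Rightarrow> real ^ 'd \<Rightarrow> real \<Rightarrow> ('d option) sqmat" where
  "block A b c e = (\<chi> i j. case i of
      Some k \<Rightarrow> (case j of Some l \<Rightarrow> A $ k $ l | None \<Rightarrow> b $ k)
    | None \<Rightarrow> (case j of Some l \<Rightarrow> c $ l | None \<Rightarrow> e))"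

lemma sum_option: "(\<Sum>i\<in>UNIV. f i) = f None + (\<Sum>k\<in>UNIV. f (Some k))"
  for f :: "('d::finite) option \<Rightarrow> 'b::comm_monoid_add"
  by (simp add: UNIV_option_conv sum.reindex)

lemma prod_option: "(\<Prod>i\<in>UNIV. f i) = f None * (\<Prod>k\<in>UNIV. f (Some k))"
  for f :: "('d::finite) option \<Rightarrow> 'b::comm_monoid_mult"
  by (simp add: UNIV_option_conv prod.reindex)

lemma block_nth [simp]:
  "block A b c e $ Some k $ Some l = A $ k $ l"
  "block A b c e $ Some k $ None = b $ k"
  "block A b c e $ None $ Some l = c $ l"
  "block A b c e $ None $ None = e"
  by (simp_all add: block_def)

lemma block_eqI:
  fixes M N :: "(('d::finite) option) sqmat"
  assumes "\<And>k l. M $ Some k $ Some l = N $ Some k $ Some l"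
    and "\<And>k. M $ Some k $ None = N $ Some k $ None"
    and "\<And>l. M $ None $ Some l = N $ None $ Some l"
    and "M $ None $ None = N $ None $ None"
  shows "M = N"
  unfolding vec_eq_iff
  by (intro allI) (metis assms not_None_eq)

lemma affine_mat_eq_block: "affine_mat \<mu> b = block \<mu> b 0 1"
  by (rule block_eqI) (simp_all add: affine_mat_def)

lemma mat_1_eq_block: "mat 1 = block (mat 1) 0 0 1"
  by (rule block_eqI) (simp_all add: mat_def)

lemma transpose_block: "transpose (block A b c e) = block (transpose A) c b e"
  by (rule block_eqI) (simp_all add: transpose_def)

lemma block_add: "block A b c e + block A' b' c' e' = block (A + A') (b + b') (c + c') (e + e')"
  by (rule block_eqI) simp_all

lemma block_diff: "block A b c e - block A' b' c' e' = block (A - A') (b - b') (c - c') (e - e')"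
  by (rule block_eqI) simp_all

lemma block_mult:
  "block A b c e ** block A' b' c' e' =
    block (A ** A' + outer b c') (A *v b' + e' *\<^sub>R b) (c v* A' + e *\<^sub>R c') (c \<bullet> b' + e * e')"
  by (rule block_eqI)
    (simp_all add: matrix_matrix_mult_def sum_option outer_def matrix_vector_mult_def
      vector_matrix_mult_def inner_vec_def algebra_simps)

text \<open>Splitting off the last coordinate reduces positive definiteness of a block matrix to an
  inequality in a vector \<open>y\<close> and a scalar \<open>z\<close>.\<close>

lemma inner_block:
  "x \<bullet> (block A b c e *v x) =
    (let y = (\<chi> k. x $ Some k); z = x $ None in y \<bullet> (A *v y) + z * ((b + c) \<bullet> y) + e * z\<^sup>2)"
  by (simp add: Let_def matrix_vector_mult_def inner_vec_def sum_option algebra_simps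
      sum.distrib sum_distrib_left power2_eq_square)

section \<open>Frobenius norms of block matrices\<close>

lemma norm_sqr_matrix: "(norm A)\<^sup>2 = (\<Sum>i\<in>UNIV. \<Sum>j\<in>UNIV. (A $ i $ j)\<^sup>2)"
  for A :: "real ^ 'n ^ 'm"
  by (simp add: norm_vec_def L2_set_def sum_nonneg)

lemma norm_sqr_vec: "(norm x)\<^sup>2 = (\<Sum>i\<in>UNIV. (x $ i)\<^sup>2)"
  for x :: "real ^ 'n"
  by (simp add: norm_vec_def L2_set_def sum_nonneg)

lemma norm_sqr_block:
  "(norm (block A b c e))\<^sup>2 = (norm A)\<^sup>2 + (norm b)\<^sup>2 + (norm c)\<^sup>2 + e\<^sup>2"
  by (simp add: norm_sqr_matrix norm_sqr_vec sum_option sum.distrib)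

lemma norm_block_le: "norm (block A b c e) \<le> norm A + norm b + norm c + \<bar>e\<bar>"
  by (rule power2_le_imp_le) (simp_all add: norm_sqr_block power2_sum algebra_simps)

section \<open>Rank-one matrices and matrix arithmetic\<close>

lemma outer_scaleR: "outer (r *\<^sub>R b) c = r *\<^sub>R outer b c" "outer b (r *\<^sub>R c) = r *\<^sub>R outer b c"
  by (simp_all add: outer_def vec_eq_iff)

lemma outer_minus: "outer (- b) c = - outer b c" "outer b (- c) = - outer b c"
  by (simp_all add: outer_def vec_eq_iff)

lemma outer_zero: "outer 0 c = 0" "outer b 0 = 0"
  by (simp_all add: outer_def vec_eq_iff)

lemma outer_mult_vec: "outer b c *v x = (c \<bullet> x) *\<^sub>R b"
  by (simp add: outer_def matrix_vector_mult_def inner_vec_def vec_eq_iff sum_distrib_left mult_ac)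

lemma vec_mult_outer: "x v* outer b c = (b \<bullet> x) *\<^sub>R c"
  by (simp add: outer_def vector_matrix_mult_def inner_vec_def vec_eq_iff sum_distrib_left
      sum_distrib_right mult_ac)

lemma outer_mult_outer: "outer b c ** outer b' c' = (c \<bullet> b') *\<^sub>R outer b c'"
  by (simp add: outer_def matrix_matrix_mult_def inner_vec_def vec_eq_iff sum_distrib_left
      sum_distrib_right mult_ac)

lemma matrix_mult_outer: "A ** outer b c = outer (A *v b) c"
  by (simp add: outer_def matrix_matrix_mult_def matrix_vector_mult_def vec_eq_iff
      sum_distrib_left mult_ac)

lemma outer_mult_matrix: "outer b c ** A = outer b (c v* A)"
  by (simp add: outer_def matrix_matrix_mult_def vector_matrix_mult_def vec_eq_iff
      sum_distrib_left mult_ac)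

lemma norm_outer: "norm (outer b c) = norm b * norm c"
proof (rule power2_eq_imp_eq)
  show "(norm (outer b c))\<^sup>2 = (norm b * norm c)\<^sup>2"
    by (simp add: norm_sqr_matrix norm_sqr_vec power_mult_distrib outer_def sum_product)
qed simp_all

lemma matrix_mult_scaleR:
  fixes A :: "real ^ 'n ^ 'm" and B :: "real ^ 'p ^ 'n"
  shows "(r *\<^sub>R A) ** B = r *\<^sub>R (A ** B)" "A ** (r *\<^sub>R B) = r *\<^sub>R (A ** B)"
  by (simp_all add: matrix_matrix_mult_def vec_eq_iff sum_distrib_left mult_ac)

lemma matrix_mult_diff:
  fixes A :: "real ^ 'n ^ 'm" and B :: "real ^ 'p ^ 'n"
  shows "(A - A') ** B = A ** B - A' ** B" "A ** (B - B') = A ** B - A ** B'"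
  by (simp_all add: matrix_matrix_mult_def vec_eq_iff sum_subtractf algebra_simps)

lemma vec_mult_matrix_arith:
  fixes A :: "real ^ 'n ^ 'm"
  shows "x v* (A - A') = x v* A - x v* A'" "x v* (r *\<^sub>R A) = r *\<^sub>R (x v* A)"
    "(- x) v* A = - (x v* A)" "(r *\<^sub>R x) v* A = r *\<^sub>R (x v* A)"
  by (simp_all add: vector_matrix_mult_def vec_eq_iff sum_subtractf algebra_simps
      sum_distrib_left sum_negf)

lemma matrix_mult_vec_arith:
  fixes A :: "real ^ 'n ^ 'm"
  shows "(A - A') *v x = A *v x - A' *v x" "(r *\<^sub>R A) *v x = r *\<^sub>R (A *v x)"
    "A *v (- x) = - (A *v x)" "A *v (r *\<^sub>R x) = r *\<^sub>R (A *v x)"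
  by (simp_all add: matrix_vector_mult_def vec_eq_iff sum_subtractf algebra_simps
      sum_distrib_left sum_negf)

text \<open>Both sides are multiplicative, so it suffices to treat the generators of
  \<open>induct_matrix_elementary\<close>: matrices with a zero row, diagonal matrices,
  transpositions and shears. The embedding keeps each of these kinds.\<close>

lemma det_block_diag: "det (block A 0 0 1) = det A"
  for A :: "('d::finite) sqmat"
proof (induction A rule: induct_matrix_elementary)
  case (1 A B)
  have "block (A ** B) 0 0 1 = block A 0 0 1 ** block B 0 0 1"
    by (simp add: block_mult outer_zero)
  with 1 show ?case by (simp add: det_mul)
next
  case (2 A i)
  have "row (Some i) (block A 0 0 1) = 0"
    unfolding vec_eq_iff
  proof
    fix j show "row (Some i) (block A 0 0 1) $ j = 0 $ j"
      using 2 by (cases j) (simp_all add: row_def vec_eq_iff)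
  qed
  with 2 show ?case by (simp add: det_zero_row)
next
  case (3 A)
  have "det (block A 0 0 1) = (\<Prod>i\<in>UNIV. block A 0 0 1 $ i $ i)"
  proof (rule det_diagonal)
    fix i j :: "'d option" assume "i \<noteq> j"
    then show "block A 0 0 1 $ i $ j = 0"
      by (cases i; cases j) (simp_all add: 3)
  qed
  with 3 show ?case by (simp add: prod_option det_diagonal)
next
  case (4 m n)
  \<comment> \<open>Stated for an arbitrary index type, as is \<open>plus\<close> below, since it is
    applied over both \<open>'d\<close> and \<open>'d option\<close>.\<close>
  have swap: "det (\<chi> i j. mat 1 $ i $ Transposition.transpose a b j) = (-1 :: real)"
    if "a \<noteq> b" for a b :: "'n::finite"
    using that
    by (simp add: det_permute_columns[OF permutes_swap_id] sign_swap_id)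
  have "block (\<chi> i j. mat 1 $ i $ Transposition.transpose m n j) 0 0 1 =
      ((\<chi> i j. mat 1 $ i $ Transposition.transpose (Some m) (Some n) j) :: ('d option) sqmat)"
    by (rule block_eqI) (simp_all add: mat_def Transposition.transpose_def)
  with 4 swap[of m n] swap[of "Some m" "Some n"] show ?case by simp
next
  case (5 m n c)
  have plus: "det (\<chi> i j. if i = a \<and> j = b then c else of_bool (i = j)) = 1"
    if "a \<noteq> b" for a b :: "'n::finite"
  proof -
    have "(\<chi> i j. if i = a \<and> j = b then c else of_bool (i = j)) =
        (\<chi> k. if k = a then row a (mat 1) + c *s row b (mat 1) else row k (mat 1))"
      using that by (auto simp: vec_eq_iff row_def mat_def)
    then show ?thesis using det_row_operation[OF that, of "mat 1" c] by simp
  qed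
  have "block (\<chi> i j. if i = m \<and> j = n then c else of_bool (i = j)) 0 0 1 =
      (\<chi> i j. if i = Some m \<and> j = Some n then c else of_bool (i = j))"
    by (rule block_eqI) simp_all
  with 5 plus[of m n] plus[of "Some m" "Some n"] show ?case by simp
qed

section \<open>Uniqueness of the polar decomposition\<close>

text \<open>Symmetry of \<open>D\<close> turns its columns into its rows, so the diagonal entries of
  \<open>D ** H ** D\<close> are values of the quadratic form of \<open>H\<close>, and positivity of
  \<open>H\<close> becomes visible in a trace.\<close>

lemma trace_conj:
  fixes D H :: "('n::finite) sqmat"
  assumes "transpose D = D"
  shows "trace (D ** H ** D) = (\<Sum>i\<in>UNIV. row i D \<bullet> (H *v row i D))"
proof -
  have D: "D $ i $ j = D $ j $ i" for i j
    using assms by (metis transpose_def vec_lambda_beta)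
  have "(D ** H ** D) $ i $ i = row i D \<bullet> (H *v row i D)" for i
  proof -
    have "(D ** H ** D) $ i $ i = (\<Sum>k\<in>UNIV. D $ i $ k * (\<Sum>l\<in>UNIV. H $ k $ l * D $ l $ i))"
      unfolding matrix_mul_assoc[symmetric] by (simp add: matrix_matrix_mult_def)
    also have "\<dots> = row i D \<bullet> (H *v row i D)"
      by (simp add: row_def inner_vec_def matrix_vector_mult_def D[of _ i])
    finally show ?thesis .
  qed
  then show ?thesis by (simp add: trace_def)
qed

text \<open>With \<open>D = H - K\<close> one has \<open>H D + D K = 0\<close>, so \<open>tr (D H D) + tr (D K D) = 0\<close>, and both
  traces are sums of values of positive definite forms. This avoids the spectral theorem.\<close>

lemma spd_matrix_sqrt_unique:
  fixes H K :: "('n::finite) sqmat"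
  assumes H: "spd_matrix H" and K: "spd_matrix K" and eq: "H ** H = K ** K"
  shows "H = K"
proof -
  define D where "D = H - K"
  have D: "transpose D = D"
    using H K by (simp add: D_def spd_matrix_def transpose_def vec_eq_iff)
  \<comment> \<open>The mixed terms \<open>H ** K\<close> cancel, leaving
    \<open>H ** H - K ** K\<close>.\<close>
  have "H ** D + D ** K = 0"
    by (simp add: D_def matrix_mult_diff eq)
  then have "D ** (H ** D) + D ** (D ** K) = 0"
    by (metis matrix_add_ldistrib times0_right)
  then have "trace (D ** (H ** D)) + trace (D ** (D ** K)) = 0"
    by (metis trace_add trace_0 mat_0)
  \<comment> \<open>Cyclicity of the trace moves one \<open>D\<close> to the right, into the shape
    of \<open>trace_conj\<close>.\<close>
  moreover have "trace (D ** (D ** K)) = trace (D ** K ** D)"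
    by (rule trace_mul_sym)
  ultimately have "trace (D ** H ** D) + trace (D ** K ** D) = 0"
    by (simp add: matrix_mul_assoc)
  then have sum0: "(\<Sum>i\<in>UNIV. row i D \<bullet> (H *v row i D) + row i D \<bullet> (K *v row i D)) = 0"
    by (simp add: trace_conj[OF D] sum.distrib)
  have nonneg: "x \<bullet> (H *v x) \<ge> 0" "x \<bullet> (K *v x) \<ge> 0" for x
    using H K unfolding spd_matrix_def by (metis inner_zero_left less_eq_real_def)+
  have "row i D = 0" for i
  proof (rule ccontr)
    assume "row i D \<noteq> 0"
    then have "row i D \<bullet> (H *v row i D) > 0" using H by (simp add: spd_matrix_def)
    moreover have "row i D \<bullet> (H *v row i D) + row i D \<bullet> (K *v row i D) = 0"
      using sum0 by (subst (asm) sum_nonneg_eq_0_iff) (auto intro: add_nonneg_nonneg nonneg)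
    ultimately show False using nonneg(2)[of "row i D"] by linarith
  qed
  then have "D = 0" by (simp add: row_def vec_eq_iff)
  then show ?thesis by (simp add: D_def)
qed

text \<open>Cancelling the orthogonal factor gives \<open>transpose G ** G = H ** H\<close>, so the
  square root \<open>H\<close> is determined by \<open>G\<close>. Being positive definite it is
  invertible, hence \<open>U\<close> is determined too.\<close>

lemma polar_decomposition_unique:
  assumes "polar_decomposition G U H" "polar_decomposition G V K"
  shows "U = V"
proof -
  have sqr: "L ** L = transpose G ** G" if "polar_decomposition G W L" for W L
  proof -
    have "transpose G ** G = transpose L ** (transpose W ** W) ** L"
      using that by (simp add: polar_decomposition_def matrix_transpose_mul matrix_mul_assoc)
    also have "\<dots> = L ** L"
      using that by (simp add: polar_decomposition_def spd_matrix_def orthogonal_matrix_def)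
    finally show ?thesis by simp
  qed
  have "H = K"
    by (rule spd_matrix_sqrt_unique)
      (use assms sqr[OF assms(1)] sqr[OF assms(2)] in \<open>simp_all add: polar_decomposition_def\<close>)
  have "x = 0" if "H *v x = 0" for x
    using assms(1) that unfolding polar_decomposition_def spd_matrix_def
    by (metis inner_zero_right less_irrefl)
  then obtain L where "L ** H = mat 1" using matrix_left_invertible_ker by blast
  then have "H ** L = mat 1" by (simp add: matrix_left_right_inverse)
  have "U ** H = V ** H"
    using assms \<open>H = K\<close> by (simp add: polar_decomposition_def)
  then have "U ** (H ** L) = V ** (H ** L)"
    by (simp add: matrix_mul_assoc)
  then show ?thesis by (simp add: \<open>H ** L = mat 1\<close>)
qed

text \<open>By uniqueness, exhibiting one decomposition evaluates the definite description.\<close>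

lemma polar_orthogonal_factor_eq:
  assumes "polar_decomposition G U H"
  shows "polar_orthogonal_factor G = U"
  unfolding polar_orthogonal_factor_def
  using assms polar_decomposition_unique by (intro the_equality) blast+

section \<open>The orthogonal factor of a translation\<close>

text \<open>For \<open>\<alpha>\<^sup>2 + |w|\<^sup>2 = 1\<close> this is the rotation with cosine \<open>\<alpha>\<close> in the plane of \<open>w\<close> and the last
  basis vector. Since \<open>(1 - \<alpha>) / |w|\<^sup>2 = 1 / (1 + \<alpha>)\<close>, no division by \<open>|w|\<close> is needed and \<open>w = 0\<close>
  is not a special case.\<close>

definition plane_rotation :: "real \<Rightarrow> real ^ 'd \<Rightarrow> (('d::finite) option) sqmat" where
  "plane_rotation \<alpha> w = block (mat 1 - (1 / (1 + \<alpha>)) *\<^sub>R outer w w) w (- w) \<alpha>"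

lemma transpose_plane_rotation: "transpose (plane_rotation \<alpha> w) = plane_rotation \<alpha> (- w)"
proof -
  have "transpose (mat 1 - r *\<^sub>R outer w w) = mat 1 - r *\<^sub>R outer w w" for r
    by (simp add: transpose_def outer_def mat_def vec_eq_iff mult.commute)
  then show ?thesis by (simp add: plane_rotation_def transpose_block outer_minus)
qed

lemma id_minus_outer_mult:
  "(mat 1 - s *\<^sub>R outer w w) ** (mat 1 - t *\<^sub>R outer w w) =
    mat 1 - (s + t - s * t * (w \<bullet> w)) *\<^sub>R outer w w"
  by (simp add: matrix_mult_diff matrix_mult_scaleR outer_mult_outer algebra_simps)

lemma id_minus_outer_mult_vec: "(mat 1 - s *\<^sub>R outer w w) *v x = x - (s * (w \<bullet> x)) *\<^sub>R w"
  by (simp add: matrix_mult_vec_arith outer_mult_vec)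

text \<open>\<open>mat 1 - s *\<^sub>R outer w w\<close> is the identity orthogonally to
  \<open>w\<close> and scales \<open>w\<close> by \<open>\<alpha>\<close>, because
  \<open>w \<bullet> w = (1 - \<alpha>) * (1 + \<alpha>)\<close>. Its square therefore scales
  \<open>w\<close> by \<open>\<alpha>\<^sup>2 = 1 - w \<bullet> w\<close>.\<close>

lemma id_minus_outer_unit:
  fixes w :: "real ^ 'n"
  assumes "\<alpha>\<^sup>2 + w \<bullet> w = 1" "\<alpha> \<ge> 0"
  defines "s \<equiv> 1 / (1 + \<alpha>)"
  shows "s * (w \<bullet> w) = 1 - \<alpha>"
    and "(mat 1 - s *\<^sub>R outer w w) ** (mat 1 - s *\<^sub>R outer w w) = mat 1 - outer w w"
proof -
  have s: "s * (1 + \<alpha>) = 1" using assms(2) by (simp add: s_def)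
  have n: "w \<bullet> w = (1 - \<alpha>) * (1 + \<alpha>)" using assms(1) by (simp add: algebra_simps power2_eq_square)
  show sn: "s * (w \<bullet> w) = 1 - \<alpha>" unfolding n using s by (metis mult.commute mult.left_commute mult.right_neutral)
  have c: "s + s - s * s * (w \<bullet> w) = 1"
  proof -
    have "s + s - s * s * (w \<bullet> w) = s + s - s * (1 - \<alpha>)" by (simp add: mult.assoc sn)
    also have "\<dots> = s * (1 + \<alpha>)" by (simp add: algebra_simps)
    finally show ?thesis using s by simp
  qed
  show "(mat 1 - s *\<^sub>R outer w w) ** (mat 1 - s *\<^sub>R outer w w) = mat 1 - outer w w"
    unfolding id_minus_outer_mult c by simp
qed

lemma plane_rotation_mult_transpose:
  assumes "\<alpha>\<^sup>2 + w \<bullet> w = 1" "\<alpha> \<ge> 0"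
  shows "plane_rotation \<alpha> w ** transpose (plane_rotation \<alpha> w) = mat 1"
proof -
  define s where "s = 1 / (1 + \<alpha>)"
  have sn: "s * (w \<bullet> w) = 1 - \<alpha>"
    and c': "(mat 1 - s *\<^sub>R outer w w) ** (mat 1 - s *\<^sub>R outer w w) = mat 1 - outer w w"
    unfolding s_def using assms by (intro id_minus_outer_unit; simp)+
  have "plane_rotation \<alpha> w ** transpose (plane_rotation \<alpha> w) =
      block (mat 1 - outer w w + outer w w)
        (- (w - (s * (w \<bullet> w)) *\<^sub>R w) + \<alpha> *\<^sub>R w) (- (w - (s * (w \<bullet> w)) *\<^sub>R w) + \<alpha> *\<^sub>R w)
        (w \<bullet> w + \<alpha> * \<alpha>)"
    unfolding transpose_plane_rotation
    by (simp add: plane_rotation_def s_def[symmetric] outer_minus block_mult c'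
        outer_mult_vec vec_mult_outer vec_mult_matrix_arith matrix_mult_vec_arith)
  \<comment> \<open>By \<open>sn\<close> both off-diagonal blocks are
    \<open>- \<alpha> *\<^sub>R w + \<alpha> *\<^sub>R w\<close>.\<close>
  also have "\<dots> = mat 1"
    unfolding sn mat_1_eq_block using assms(1)
    by (simp add: algebra_simps power2_eq_square)
  finally show ?thesis .
qed

text \<open>Double-angle formulas: for \<open>\<beta> = cos t\<close> and
  \<open>norm u = sin t\<close>, the new parameters are \<open>cos (2 * t)\<close> and a vector of
  length \<open>sin (2 * t)\<close>. Positivity of \<open>\<beta>\<close> keeps the denominator
  \<open>1 + cos (2 * t) = 2 * \<beta>\<^sup>2\<close> nonzero.\<close>

lemma plane_rotation_square:
  assumes "\<beta>\<^sup>2 + u \<bullet> u = 1" "\<beta> > 0"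
  shows "plane_rotation \<beta> u ** plane_rotation \<beta> u = plane_rotation (2 * \<beta>\<^sup>2 - 1) ((2 * \<beta>) *\<^sub>R u)"
proof -
  define s where "s = 1 / (1 + \<beta>)"
  have sn: "s * (u \<bullet> u) = 1 - \<beta>"
    and c': "(mat 1 - s *\<^sub>R outer u u) ** (mat 1 - s *\<^sub>R outer u u) = mat 1 - outer u u"
    unfolding s_def using assms by (intro id_minus_outer_unit; simp)+
  have "plane_rotation \<beta> u ** plane_rotation \<beta> u =
      block (mat 1 - outer u u - outer u u)
        (u - (s * (u \<bullet> u)) *\<^sub>R u + \<beta> *\<^sub>R u) (- (u - (s * (u \<bullet> u)) *\<^sub>R u) - \<beta> *\<^sub>R u)
        (\<beta> * \<beta> - u \<bullet> u)"
    by (simp add: plane_rotation_def s_def[symmetric] outer_minus block_mult c'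
        outer_mult_vec vec_mult_outer vec_mult_matrix_arith matrix_mult_vec_arith)
  also have "\<dots> = plane_rotation (2 * \<beta>\<^sup>2 - 1) ((2 * \<beta>) *\<^sub>R u)"
  proof -
    \<comment> \<open>The coefficient of \<open>outer u u\<close> on the right-hand side; it matches
      the two copies subtracted on the left.\<close>
    have "1 / (1 + (2 * \<beta>\<^sup>2 - 1)) * (2 * \<beta> * (2 * \<beta>)) = 2"
      using assms(2) by (simp add: power2_eq_square)
    then have A: "mat 1 - outer u u - outer u u =
        mat 1 - (1 / (1 + (2 * \<beta>\<^sup>2 - 1))) *\<^sub>R outer ((2 * \<beta>) *\<^sub>R u) ((2 * \<beta>) *\<^sub>R u)"
      unfolding outer_scaleR scaleR_scaleR mult.assoc by (simp add: scaleR_2)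
    have b: "u - (1 - \<beta>) *\<^sub>R u + \<beta> *\<^sub>R u = (2 * \<beta>) *\<^sub>R u"
      "- (u - (1 - \<beta>) *\<^sub>R u) - \<beta> *\<^sub>R u = - ((2 * \<beta>) *\<^sub>R u)"
      by (simp_all add: vec_eq_iff algebra_simps)
    have e: "\<beta> * \<beta> - u \<bullet> u = 2 * \<beta>\<^sup>2 - 1"
      using assms(1) by (simp add: power2_eq_square)
    show ?thesis unfolding plane_rotation_def sn A b e ..
  qed
  finally show ?thesis .
qed

lemma orthogonal_plane_rotation:
  assumes "\<alpha>\<^sup>2 + w \<bullet> w = 1" "\<alpha> \<ge> 0"
  shows "orthogonal_matrix (plane_rotation \<alpha> w)"
  using plane_rotation_mult_transpose[OF assms]
  by (simp add: orthogonal_matrix_def matrix_left_right_inverse)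

text \<open>A rotation is the square of the rotation by half the angle, so its determinant \<open>\<plusminus>1\<close>
  is a square.\<close>

lemma det_plane_rotation:
  assumes "\<alpha>\<^sup>2 + w \<bullet> w = 1" "\<alpha> \<ge> 0"
  shows "det (plane_rotation \<alpha> w) = 1"
proof -
  \<comment> \<open>\<open>\<beta>\<close> is the cosine of half the angle, and \<open>u\<close> is
    chosen so that \<open>(2 * \<beta>) *\<^sub>R u = w\<close>.\<close>
  define \<beta> where "\<beta> = sqrt ((1 + \<alpha>) / 2)"
  define u where "u = (1 / (2 * \<beta>)) *\<^sub>R w"
  have \<beta>: "\<beta> > 0" "\<beta>\<^sup>2 = (1 + \<alpha>) / 2" using assms(2) by (simp_all add: \<beta>_def)
  have n: "w \<bullet> w = (1 - \<alpha>) * (1 + \<alpha>)"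
    using assms(1) by (simp add: algebra_simps power2_eq_square)
  have "u \<bullet> u = (w \<bullet> w) / (4 * \<beta>\<^sup>2)"
    by (simp add: u_def power2_eq_square)
  also have "4 * \<beta>\<^sup>2 = 2 * (1 + \<alpha>)"
    unfolding \<beta>(2) by simp
  also have "w \<bullet> w / (2 * (1 + \<alpha>)) = ((1 - \<alpha>) * (1 + \<alpha>)) / (2 * (1 + \<alpha>))"
    unfolding n ..
  also have "\<dots> = (1 - \<alpha>) / 2"
    using assms(2) by (intro mult_divide_mult_cancel_right) simp
  finally have 1: "\<beta>\<^sup>2 + u \<bullet> u = 1" by (simp add: \<beta> field_simps)
  have "plane_rotation \<beta> u ** plane_rotation \<beta> u = plane_rotation \<alpha> w"
  proof -
    have "2 * \<beta>\<^sup>2 - 1 = \<alpha>" unfolding \<beta>(2) by (simp add: field_simps)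
    moreover have "(2 * \<beta>) *\<^sub>R u = w" using \<beta>(1) by (simp add: u_def)
    ultimately show ?thesis using plane_rotation_square[OF 1 \<beta>(1)] by simp
  qed
  then have "det (plane_rotation \<alpha> w) = (det (plane_rotation \<beta> u))\<^sup>2"
    by (metis det_mul power2_eq_square)
  also have "\<dots> = 1"
    using det_orthogonal_matrix[OF orthogonal_plane_rotation[OF 1]] \<beta>(1) by auto
  finally show ?thesis .
qed

text \<open>Orthogonality of \<open>\<mu>\<close> preserves the identity in the upper left block,
  and conjugation turns \<open>outer w w\<close> into
  \<open>outer (\<mu> *v w) (\<mu> *v w)\<close>.\<close>

lemma plane_rotation_conj:
  assumes "orthogonal_matrix \<mu>"
  shows "block \<mu> 0 0 1 ** plane_rotation \<alpha> w ** block (transpose \<mu>) 0 0 1 =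
    plane_rotation \<alpha> (\<mu> *v w)"
proof -
  have "\<mu> ** transpose \<mu> = mat 1" using assms by (simp add: orthogonal_matrix_def)
  then show ?thesis
    by (simp add: plane_rotation_def block_mult outer_zero matrix_mult_diff matrix_mult_scaleR
        matrix_mult_outer outer_mult_matrix vec_mult_matrix_arith matrix_mult_vec_arith)
qed

text \<open>With \<open>k = tilt_scale v\<close>, the matrix \<open>tilt v\<close> has cosine
  \<open>2 * k\<close> and sine \<open>k * norm v\<close>: the angle with tangent
  \<open>norm v / 2\<close>.\<close>

definition tilt_scale :: "real ^ 'd \<Rightarrow> real" where
  "tilt_scale v = 1 / sqrt (4 + v \<bullet> v)"

definition tilt :: "real ^ 'd \<Rightarrow> (('d::finite) option) sqmat" where
  "tilt v = plane_rotation (2 * tilt_scale v) (tilt_scale v *\<^sub>R v)"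

lemma tilt_scale_pos: "tilt_scale v > 0"
  by (simp add: tilt_scale_def add_pos_nonneg)

lemma tilt_scale_sqr: "(2 * tilt_scale v)\<^sup>2 + (tilt_scale v)\<^sup>2 * (v \<bullet> v) = 1"
proof -
  have "4 + v \<bullet> v > 0" by (simp add: add_pos_nonneg)
  then show ?thesis
    by (simp add: tilt_scale_def power_divide power_mult_distrib add_divide_distrib[symmetric])
qed

lemma tilt_scale_unit:
  "(2 * tilt_scale v)\<^sup>2 + (tilt_scale v *\<^sub>R v) \<bullet> (tilt_scale v *\<^sub>R v) = 1"
  using tilt_scale_sqr[of v] by (simp add: power2_eq_square mult.assoc)

lemma tilt_scale_le: "2 * tilt_scale v \<le> 1" "tilt_scale v * norm v \<le> 1"
proof -
  have eq: "(2 * tilt_scale v)\<^sup>2 + (tilt_scale v * norm v)\<^sup>2 = 1"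
    using tilt_scale_sqr[of v] by (simp only: power_mult_distrib power2_norm_eq_inner)
  have le1: "a \<le> 1" if "a\<^sup>2 + b\<^sup>2 = 1" for a b :: real
  proof -
    have "a\<^sup>2 \<le> 1" using that zero_le_power2[of b] by linarith
    then show ?thesis unfolding abs_square_le_1 by linarith
  qed
  show "2 * tilt_scale v \<le> 1" using le1[OF eq] .
  show "tilt_scale v * norm v \<le> 1" using eq le1[of _ "2 * tilt_scale v"] by (simp only: add.commute)
qed

lemma orthogonal_tilt: "orthogonal_matrix (tilt v)"
  unfolding tilt_def using tilt_scale_pos[of v]
  by (intro orthogonal_plane_rotation tilt_scale_unit) simp

lemma det_tilt: "det (tilt v) = 1"
  unfolding tilt_def using tilt_scale_pos[of v]
  by (intro det_plane_rotation tilt_scale_unit) simp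

lemma transpose_tilt: "transpose (tilt v) = tilt (- v)"
  by (simp add: tilt_def transpose_plane_rotation tilt_scale_def)

lemma tilt_conj:
  assumes "orthogonal_matrix \<mu>"
  shows "block \<mu> 0 0 1 ** tilt v ** block (transpose \<mu>) 0 0 1 = tilt (\<mu> *v v)"
proof -
  \<comment> \<open>\<open>tilt_scale\<close> depends on \<open>v\<close> through its length, which
    \<open>\<mu>\<close> preserves.\<close>
  have "(\<mu> *v v) \<bullet> (\<mu> *v v) = v \<bullet> v"
    using assms orthogonal_transformation_matrix[of "(*v) \<mu>"]
    by (simp add: orthogonal_transformation_def)
  then show ?thesis
    by (simp add: tilt_def plane_rotation_conj[OF assms] matrix_mult_vec_arith tilt_scale_def)
qed

text \<open>This is the symmetric factor of the translation by \<open>v\<close>. Symmetry amounts to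
  \<open>A *v v = (2 * k) *\<^sub>R v\<close> for the upper left block \<open>A\<close>, which the
  choice of angle provides; positivity follows from Cauchy-Schwarz and completing a square.\<close>

lemma spd_tilt: "spd_matrix (transpose (tilt v) ** affine_mat (mat 1) v)"
proof -
  define k where "k = tilt_scale v"
  define s where "s = 1 / (1 + 2 * k)"
  define A where "A = mat 1 - s *\<^sub>R outer (k *\<^sub>R v) (k *\<^sub>R v)"
  have k: "k > 0" unfolding k_def by (rule tilt_scale_pos)
  have s: "s > 0" using k by (simp add: s_def)
  have "k\<^sup>2 * (v \<bullet> v) = (1 - 2 * k) * (1 + 2 * k)"
    using tilt_scale_sqr[of v] by (simp add: k_def[symmetric] algebra_simps power2_eq_square)
  moreover have "s * (1 + 2 * k) = 1" using k by (simp add: s_def)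
  ultimately have sn: "s * (k\<^sup>2 * (v \<bullet> v)) = 1 - 2 * k"
    by (metis mult.commute mult.left_commute mult.right_neutral)
  have "v - (s * ((k *\<^sub>R v) \<bullet> v)) *\<^sub>R (k *\<^sub>R v) - k *\<^sub>R v = v - (s * (k\<^sup>2 * (v \<bullet> v))) *\<^sub>R v - k *\<^sub>R v"
    by (simp add: power2_eq_square mult_ac)
  also have "\<dots> = k *\<^sub>R v" unfolding sn by (simp add: vec_eq_iff algebra_simps)
  \<comment> \<open>The upper right block of the product thus equals its lower left block
    \<open>k *\<^sub>R v\<close>.\<close>
  finally have b: "A *v v + - (k *\<^sub>R v) = k *\<^sub>R v"
    by (simp only: A_def id_minus_outer_mult_vec add_uminus_conv_diff)
  have "transpose (tilt v) = block A (- (k *\<^sub>R v)) (k *\<^sub>R v) (2 * k)"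
    unfolding tilt_def transpose_plane_rotation
    by (simp add: plane_rotation_def outer_minus A_def s_def k_def)
  then have H: "transpose (tilt v) ** affine_mat (mat 1) v =
      block A (k *\<^sub>R v) (k *\<^sub>R v) (k * (v \<bullet> v) + 2 * k)"
    by (simp add: affine_mat_eq_block block_mult outer_zero b del: add_uminus_conv_diff)
  have "transpose A = A"
    by (simp add: A_def transpose_def outer_def mat_def vec_eq_iff mult.commute)
  moreover have "x \<bullet> (block A (k *\<^sub>R v) (k *\<^sub>R v) (k * (v \<bullet> v) + 2 * k) *v x) > 0" if "x \<noteq> 0" for x
  proof -
    define y where "y = (\<chi> l. x $ Some l)"
    define z where "z = x $ None"
    have yz: "y \<noteq> 0 \<or> z \<noteq> 0"
    proof (rule ccontr)
      assume "\<not> ?thesis"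
      then have "x $ i = 0" for i
        by (cases i) (simp_all add: y_def z_def vec_eq_iff)
      with that show False by (simp add: vec_eq_iff)
    qed
    \<comment> \<open>The quadratic form of \<open>A\<close> is at least \<open>2 * k\<close> times
      the squared length, with equality along \<open>v\<close>.\<close>
    have "y \<bullet> (A *v y) = y \<bullet> y - s * k\<^sup>2 * (v \<bullet> y)\<^sup>2"
      by (simp add: A_def id_minus_outer_mult_vec inner_diff_right power2_eq_square inner_commute)
    also have "\<dots> \<ge> y \<bullet> y - s * k\<^sup>2 * ((v \<bullet> v) * (y \<bullet> y))"
      using s by (intro diff_left_mono mult_left_mono Cauchy_Schwarz_ineq) simp
    also have "y \<bullet> y - s * k\<^sup>2 * ((v \<bullet> v) * (y \<bullet> y)) = (1 - s * (k\<^sup>2 * (v \<bullet> v))) * (y \<bullet> y)"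
      by (simp add: algebra_simps)
    finally have "y \<bullet> (A *v y) \<ge> 2 * k * (y \<bullet> y)" unfolding sn by simp
    moreover have "x \<bullet> (block A (k *\<^sub>R v) (k *\<^sub>R v) (k * (v \<bullet> v) + 2 * k) *v x) =
        y \<bullet> (A *v y) + 2 * k * z * (v \<bullet> y) + (k * (v \<bullet> v) + 2 * k) * z\<^sup>2"
      unfolding inner_block Let_def y_def[symmetric] z_def[symmetric] inner_add_left inner_scaleR_left
      by (simp only: algebra_simps)
    \<comment> \<open>Completing the square in \<open>z *\<^sub>R v + y\<close> leaves a sum of
      nonnegative terms that vanishes only for \<open>y = 0\<close> and
      \<open>z = 0\<close>.\<close>
    moreover have "2 * k * (y \<bullet> y) + 2 * k * z * (v \<bullet> y) + (k * (v \<bullet> v) + 2 * k) * z\<^sup>2 =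
        k * ((z *\<^sub>R v + y) \<bullet> (z *\<^sub>R v + y) + 2 * z\<^sup>2 + y \<bullet> y)"
      by (simp add: inner_add_left inner_add_right inner_commute[of y v] algebra_simps power2_eq_square)
    moreover have "(z *\<^sub>R v + y) \<bullet> (z *\<^sub>R v + y) + 2 * z\<^sup>2 + y \<bullet> y > 0"
    proof -
      have "y \<bullet> y > 0 \<or> z\<^sup>2 > 0" using yz by simp
      moreover have "y \<bullet> y \<ge> 0" "z\<^sup>2 \<ge> 0" "(z *\<^sub>R v + y) \<bullet> (z *\<^sub>R v + y) \<ge> 0" by simp_all
      ultimately show ?thesis by linarith
    qed
    ultimately show ?thesis using k by (smt (verit) mult_pos_pos)
  qed
  ultimately show ?thesis
    unfolding H spd_matrix_def by (simp add: transpose_block)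
qed

section \<open>Polar decomposition of Euclidean motions\<close>

lemma orthogonal_block_diag:
  assumes "orthogonal_matrix \<mu>"
  shows "orthogonal_matrix (block \<mu> 0 0 1)"
  using assms
  by (simp add: orthogonal_matrix_def transpose_block block_mult outer_zero mat_1_eq_block[symmetric])

text \<open>The motion is \<open>block \<mu> 0 0 1\<close> times the translation by
  \<open>v\<close>, and an orthogonal matrix multiplied from the left changes only the orthogonal
  factor.\<close>

lemma polar_decomposition_affine_mat:
  fixes \<mu> :: "('d::finite) sqmat" and b :: "real ^ 'd"
  assumes "orthogonal_matrix \<mu>"
  defines "v \<equiv> transpose \<mu> *v b"
  shows "polar_decomposition (affine_mat \<mu> b) (block \<mu> 0 0 1 ** tilt v)
    (transpose (tilt v) ** affine_mat (mat 1) v)"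
proof -
  have \<mu>: "\<mu> ** transpose \<mu> = mat 1" using assms by (simp add: orthogonal_matrix_def)
  have "block \<mu> 0 0 1 ** tilt v ** (transpose (tilt v) ** affine_mat (mat 1) v) =
      block \<mu> 0 0 1 ** (tilt v ** transpose (tilt v)) ** affine_mat (mat 1) v"
    by (simp add: matrix_mul_assoc)
  also have "\<dots> = block \<mu> 0 0 1 ** affine_mat (mat 1) v"
    using orthogonal_tilt[of v] by (simp add: orthogonal_matrix_def)
  also have "\<dots> = affine_mat \<mu> b"
    by (simp add: affine_mat_eq_block block_mult outer_zero v_def matrix_vector_mul_assoc \<mu>
        del: transpose_matrix_vector)
  finally show ?thesis
    unfolding polar_decomposition_def
    using assms spd_tilt orthogonal_tilt by (auto intro!: orthogonal_matrix_mul orthogonal_block_diag)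
qed

lemma Phi_affine_mat:
  assumes "orthogonal_matrix \<mu>"
  shows "Phi r (affine_mat \<mu> b) = block \<mu> 0 0 1 ** tilt ((transpose \<mu> *v b) /\<^sub>R r)"
  unfolding Phi_def rescale_affine_mat
  using polar_orthogonal_factor_eq[OF polar_decomposition_affine_mat[OF assms, of "b /\<^sub>R r"]]
  by (simp add: matrix_mult_vec_arith)

section \<open>First-order expansion\<close>

text \<open>Each entry of the product is an inner product of a row and a column, so Cauchy-Schwarz
  applies entrywise to the Frobenius norm.\<close>

lemma norm_matrix_mult_le: "norm (A ** B) \<le> norm A * norm B"
  for A :: "real ^ 'n ^ 'm" and B :: "real ^ 'p ^ 'n"
proof (rule power2_le_imp_le)
  have "(norm (A ** B))\<^sup>2 = (\<Sum>i\<in>UNIV. \<Sum>j\<in>UNIV. (A $ i \<bullet> column j B)\<^sup>2)"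
    by (simp add: norm_sqr_matrix matrix_matrix_mult_def inner_vec_def column_def)
  also have "\<dots> \<le> (\<Sum>i\<in>UNIV. \<Sum>j\<in>UNIV. (A $ i \<bullet> A $ i) * (column j B \<bullet> column j B))"
    by (intro sum_mono Cauchy_Schwarz_ineq)
  also have "\<dots> = (\<Sum>i\<in>UNIV. A $ i \<bullet> A $ i) * (\<Sum>j\<in>UNIV. column j B \<bullet> column j B)"
    by (simp add: sum_product)
  also have "(\<Sum>j\<in>UNIV. column j B \<bullet> column j B) = (norm B)\<^sup>2"
    unfolding norm_sqr_matrix inner_vec_def column_def
    by (subst sum.swap) (simp add: power2_eq_square)
  also have "(\<Sum>i\<in>UNIV. A $ i \<bullet> A $ i) = (norm A)\<^sup>2"
    unfolding norm_sqr_matrix by (simp add: inner_vec_def power2_eq_square)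
  finally show "(norm (A ** B))\<^sup>2 \<le> (norm A * norm B)\<^sup>2"
    by (simp add: power_mult_distrib)
qed simp

text \<open>The derivative of \<open>tilt\<close> at 0, an infinitesimal rotation; the factor 1/2 is
  \<open>tilt_scale 0\<close>.\<close>

definition tilt_linear :: "real ^ 'd \<Rightarrow> (('d::finite) option) sqmat" where
  "tilt_linear v = block 0 (v /\<^sub>R 2) (- (v /\<^sub>R 2)) 0"

lemma tilt_linear_add: "tilt_linear (x + y) = tilt_linear x + tilt_linear y"
  by (simp add: tilt_linear_def block_add scaleR_add_right)

text \<open>Common source of the next two estimates: the diagonal blocks have size
  \<open>1 - 2 * k\<close>, which is of second order by
  \<open>1 - cos t \<le> (sin t)\<^sup>2\<close>.\<close>

lemma tilt_minus_one:
  fixes v :: "real ^ 'd"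
  defines "k \<equiv> tilt_scale v"
  obtains S where "tilt v - mat 1 = block S (k *\<^sub>R v) (- (k *\<^sub>R v)) (2 * k - 1)"
    and "norm S = 1 - 2 * k" and "1 - 2 * k \<le> k\<^sup>2 * (norm v)\<^sup>2"
proof
  define s where "s = 1 / (1 + 2 * k)"
  let ?S = "- (s *\<^sub>R outer (k *\<^sub>R v) (k *\<^sub>R v))"
  have k: "k > 0" unfolding k_def by (rule tilt_scale_pos)
  have n: "k\<^sup>2 * (norm v)\<^sup>2 = (1 - 2 * k) * (1 + 2 * k)"
    using tilt_scale_sqr[of v] unfolding k_def[symmetric] power2_norm_eq_inner
    by (simp add: algebra_simps power2_eq_square)
  have k1: "2 * k \<le> 1" unfolding k_def by (rule tilt_scale_le)
  show "tilt v - mat 1 = block ?S (k *\<^sub>R v) (- (k *\<^sub>R v)) (2 * k - 1)"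
    unfolding mat_1_eq_block
    by (simp add: tilt_def plane_rotation_def block_diff s_def k_def)
  have "norm ?S = s * (k\<^sup>2 * (norm v)\<^sup>2)"
    using k by (simp add: norm_outer s_def power2_eq_square mult_ac)
  also have "\<dots> = 1 - 2 * k" unfolding n using k by (simp add: s_def)
  finally show "norm ?S = 1 - 2 * k" .
  show "1 - 2 * k \<le> k\<^sup>2 * (norm v)\<^sup>2"
    unfolding n using k k1 by (simp add: algebra_simps mult_left_le)
qed

text \<open>Since \<open>k * norm v \<le> 1\<close>, the second-order bound on
  \<open>1 - 2 * k\<close> weakens to \<open>k * norm v\<close>, and \<open>2 * k \<le> 1\<close>
  does the rest.\<close>

lemma norm_tilt_minus_one_le: "norm (tilt v - mat 1) \<le> 2 * norm v"
proof -
  define k where "k = tilt_scale v"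
  obtain S where S: "tilt v - mat 1 = block S (k *\<^sub>R v) (- (k *\<^sub>R v)) (2 * k - 1)"
    "norm S = 1 - 2 * k" "1 - 2 * k \<le> k\<^sup>2 * (norm v)\<^sup>2"
    using tilt_minus_one[of v] unfolding k_def by blast
  have k: "0 < k" "2 * k \<le> 1" "k * norm v \<le> 1"
    unfolding k_def by (fact tilt_scale_pos tilt_scale_le)+
  have "k\<^sup>2 * (norm v)\<^sup>2 = (k * norm v) * (k * norm v)" by (simp add: power2_eq_square)
  also have "\<dots> \<le> k * norm v" using k by (intro mult_left_le) simp_all
  finally have 1: "1 - 2 * k \<le> k * norm v" using S(3) by linarith
  have 2: "2 * (k * norm v) \<le> norm v" using mult_right_mono[OF k(2), of "norm v"] by simp
  have "norm (tilt v - mat 1) \<le> norm S + norm (k *\<^sub>R v) + norm (- (k *\<^sub>R v)) + \<bar>2 * k - 1\<bar>"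
    unfolding S(1) by (rule norm_block_le)
  also have "\<dots> = 2 * (1 - 2 * k) + 2 * (k * norm v)" using k S(2) by simp
  also have "\<dots> \<le> 2 * norm v" using 1 2 by (simp add: right_diff_distrib)
  finally show ?thesis .
qed

text \<open>The off-diagonal error is \<open>1 / 2 - k\<close> times \<open>v\<close>, so the factor
  \<open>1 - 2 * k\<close> governs all blocks. The resulting cubic term is absorbed into the
  quadratic one by \<open>k * norm v \<le> 1\<close>, which makes the bound valid for all
  \<open>v\<close>.\<close>

lemma norm_tilt_remainder_le: "norm (tilt v - mat 1 - tilt_linear v) \<le> (norm v)\<^sup>2"
proof -
  define k where "k = tilt_scale v"
  obtain S where S: "tilt v - mat 1 = block S (k *\<^sub>R v) (- (k *\<^sub>R v)) (2 * k - 1)"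
    "norm S = 1 - 2 * k" "1 - 2 * k \<le> k\<^sup>2 * (norm v)\<^sup>2"
    using tilt_minus_one[of v] unfolding k_def by blast
  have k: "0 < k" "2 * k \<le> 1" "k * norm v \<le> 1"
    unfolding k_def by (fact tilt_scale_pos tilt_scale_le)+
  have "tilt v - mat 1 - tilt_linear v = block S (- ((1 / 2 - k) *\<^sub>R v)) ((1 / 2 - k) *\<^sub>R v) (2 * k - 1)"
    unfolding S(1) tilt_linear_def block_diff by (simp add: algebra_simps)
  then have "norm (tilt v - mat 1 - tilt_linear v) \<le>
      norm S + norm (- ((1 / 2 - k) *\<^sub>R v)) + norm ((1 / 2 - k) *\<^sub>R v) + \<bar>2 * k - 1\<bar>"
    by (simp only: norm_block_le)
  also have "\<dots> = 2 * (1 - 2 * k) + (1 - 2 * k) * norm v"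
    using k S(2) by (simp add: left_diff_distrib)
  also have "\<dots> \<le> 2 * (k\<^sup>2 * (norm v)\<^sup>2) + (k\<^sup>2 * (norm v)\<^sup>2) * norm v"
    using S(3) by (intro add_mono mult_right_mono) simp_all
  also have "\<dots> = (2 * k\<^sup>2 + k * (k * norm v)) * (norm v)\<^sup>2"
    by (simp add: algebra_simps power2_eq_square)
  also have "\<dots> \<le> 1 * (norm v)\<^sup>2"
  proof (rule mult_right_mono)
    have "k * (k * norm v) \<le> k" using k by (intro mult_left_le) simp_all
    moreover have "2 * k\<^sup>2 \<le> k" using mult_right_mono[OF k(2), of k] k(1) by (simp add: power2_eq_square)
    ultimately show "2 * k\<^sup>2 + k * (k * norm v) \<le> 1" using k(2) by linarith
  qed simp
  finally show ?thesis by simp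
qed

text \<open>Expanding the product around \<open>mat 1\<close>, the linear terms cancel by
  \<open>tilt_linear_add\<close>. What remains is three second-order remainders and the product of
  two first-order terms, which contributes the constant \<open>4 = 2 * 2\<close>.\<close>

lemma norm_tilt_add_le:
  "norm (tilt (x + y) - tilt x ** tilt y) \<le>
    (norm (x + y))\<^sup>2 + (norm x)\<^sup>2 + (norm y)\<^sup>2 + 4 * norm x * norm y"
proof -
  let ?E = "\<lambda>v. tilt v - mat 1 - tilt_linear v"
  let ?P = "(tilt x - mat 1) ** (tilt y - mat 1)"
  have "?P = tilt x ** tilt y - tilt x - tilt y + mat 1"
    by (simp add: matrix_mult_diff)
  then have "tilt (x + y) - tilt x ** tilt y = ?E (x + y) - ?E x - ?E y - ?P"
    by (simp add: tilt_linear_add algebra_simps)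
  also have "norm \<dots> \<le> norm (?E (x + y)) + norm (?E x) + norm (?E y) + norm ?P"
    by (meson add_mono norm_triangle_ineq4 order_refl order_trans)
  also have "norm ?P \<le> norm (tilt x - mat 1) * norm (tilt y - mat 1)"
    by (rule norm_matrix_mult_le)
  also have "\<dots> \<le> (2 * norm x) * (2 * norm y)"
    by (intro mult_mono norm_tilt_minus_one_le) simp_all
  finally show ?thesis
    using norm_tilt_remainder_le[of "x + y"] norm_tilt_remainder_le[of x]
      norm_tilt_remainder_le[of y] by simp
qed

section \<open>Approximate homomorphisms\<close>

lemma matrix_inv_eqI:
  fixes A B :: "('n::finite) sqmat"
  assumes "A ** B = mat 1"
  shows "matrix_inv A = B"
  unfolding matrix_inv_def
proof (rule some_equality)
  show BA: "A ** B = mat 1 \<and> B ** A = mat 1"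
    using assms by (simp add: matrix_left_right_inverse)
  fix C assume "A ** C = mat 1 \<and> C ** A = mat 1"
  then show "C = B"
    by (metis BA matrix_mul_assoc matrix_mul_lid matrix_mul_rid)
qed

lemma affine_mat_mult:
  "affine_mat \<mu> b ** affine_mat \<nu> c = affine_mat (\<mu> ** \<nu>) (\<mu> *v c + b)"
  by (simp add: affine_mat_eq_block block_mult outer_zero)

lemma matrix_inv_affine_mat:
  assumes "orthogonal_matrix \<mu>"
  shows "matrix_inv (affine_mat \<mu> b) = affine_mat (transpose \<mu>) (- (transpose \<mu> *v b))"
proof (rule matrix_inv_eqI)
  have "\<mu> ** transpose \<mu> = mat 1" using assms by (simp add: orthogonal_matrix_def)
  then show "affine_mat \<mu> b ** affine_mat (transpose \<mu>) (- (transpose \<mu> *v b)) = mat 1"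
    by (simp add: affine_mat_mult matrix_mult_vec_arith matrix_vector_mul_assoc
        del: transpose_matrix_vector) (simp add: affine_mat_eq_block mat_1_eq_block)
qed

lemma Phi_in_SO:
  assumes "g \<in> SE"
  shows "Phi r g \<in> SO"
proof -
  obtain \<mu> b where g: "g = affine_mat \<mu> b" and "rotation_matrix \<mu>"
    using assms by (auto simp: SE_def SO_def)
  then show ?thesis
    by (simp add: SO_def rotation_matrix_def Phi_affine_mat orthogonal_matrix_mul
        orthogonal_block_diag orthogonal_tilt det_mul det_tilt det_block_diag)
qed

text \<open>The inverse motion has polar factor
  \<open>transpose ?M ** tilt (\<mu> *v (- ?v))\<close>; undoing the conjugation by
  \<open>?M\<close> makes this \<open>tilt (- ?v) ** transpose ?M\<close>, the transpose of
  \<open>?M ** tilt ?v\<close>.\<close>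

lemma Phi_matrix_inv:
  assumes "g \<in> SE"
  shows "Phi r (matrix_inv g) = matrix_inv (Phi r g)"
proof -
  obtain \<mu> b where g: "g = affine_mat \<mu> b" and \<mu>: "orthogonal_matrix \<mu>"
    using assms by (auto simp: SE_def SO_def rotation_matrix_def)
  let ?M = "block \<mu> 0 0 1" and ?v = "(transpose \<mu> *v b) /\<^sub>R r"
  have M: "?M ** transpose ?M = mat 1" "transpose ?M ** ?M = mat 1"
    using orthogonal_block_diag[OF \<mu>] by (simp_all add: orthogonal_matrix_def)
  have MT: "transpose ?M = block (transpose \<mu>) 0 0 1"
    by (simp add: transpose_block)
  have "Phi r (matrix_inv g) = transpose ?M ** tilt (\<mu> *v (- ?v))"
    using \<mu> by (simp add: g matrix_inv_affine_mat Phi_affine_mat MT matrix_mult_vec_arith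
        del: transpose_matrix_vector)
  also have "\<dots> = transpose ?M ** (?M ** tilt (- ?v) ** transpose ?M)"
    by (simp only: MT tilt_conj[OF \<mu>])
  also have "\<dots> = (transpose ?M ** ?M) ** (tilt (- ?v) ** transpose ?M)"
    by (simp only: matrix_mul_assoc)
  also have "\<dots> = transpose (?M ** tilt ?v)"
    by (simp add: M matrix_transpose_mul transpose_tilt)
  also have "?M ** tilt ?v = Phi r g"
    by (simp add: g Phi_affine_mat[OF \<mu>])
  also have "transpose (Phi r g) = matrix_inv (Phi r g)"
    using Phi_in_SO[OF assms, of r]
    by (intro matrix_inv_eqI[symmetric]) (simp add: SO_def rotation_matrix_def orthogonal_matrix_def)
  finally show ?thesis .
qed

text \<open>Moving the rotation of \<open>h\<close> to the left through the tilt of \<open>g\<close>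
  brings both terms to the form \<open>?M ** ?N\<close> times tilts of the rescaled \<open>x\<close>
  and \<open>y\<close>, so that \<open>norm_tilt_add_le\<close> applies.\<close>

lemma Phi_mult_bigo:
  assumes "g \<in> SE" "h \<in> SE"
  shows "(\<lambda>r. frobenius_norm (Phi r (g ** h) - Phi r g ** Phi r h)) \<in> O[at_top](\<lambda>r. 1 / r\<^sup>2)"
proof -
  obtain \<mu> b where g: "g = affine_mat \<mu> b" and \<mu>: "orthogonal_matrix \<mu>"
    using assms by (auto simp: SE_def SO_def rotation_matrix_def)
  obtain \<nu> c where h: "h = affine_mat \<nu> c" and \<nu>: "orthogonal_matrix \<nu>"
    using assms by (auto simp: SE_def SO_def rotation_matrix_def)
  \<comment> \<open>The translation of \<open>g\<close> seen in the frame after both rotations; with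
    \<open>y\<close>, the vector of \<open>g ** h\<close> becomes \<open>x + y\<close>.\<close>
  define x where "x = transpose \<nu> *v (transpose \<mu> *v b)"
  define y where "y = transpose \<nu> *v c"
  let ?M = "block \<mu> 0 0 1" and ?N = "block \<nu> 0 0 1"
  define K where "K = (norm (x + y))\<^sup>2 + (norm x)\<^sup>2 + (norm y)\<^sup>2 + 4 * norm x * norm y"
  have \<mu>': "transpose \<mu> ** \<mu> = mat 1" and \<nu>': "\<nu> ** transpose \<nu> = mat 1"
    using \<mu> \<nu> by (simp_all add: orthogonal_matrix_def)
  \<comment> \<open>This holds for every real \<open>r\<close>: at \<open>r = 0\<close> the
    conventions \<open>inverse 0 = 0\<close> and \<open>1 / 0 = 0\<close> agree.\<close>
  have le: "norm (Phi r (g ** h) - Phi r g ** Phi r h) \<le> norm (?M ** ?N) * K * norm (1 / r\<^sup>2)"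
    for r
  proof -
    have "transpose (\<mu> ** \<nu>) *v (\<mu> *v c + b) = x + y"
      unfolding matrix_transpose_mul matrix_vector_mul_assoc[symmetric] matrix_vector_right_distrib
      by (simp add: x_def y_def matrix_vector_mul_assoc[of _ \<mu>] \<mu>' add.commute
          del: transpose_matrix_vector)
    moreover have "?M ** ?N = block (\<mu> ** \<nu>) 0 0 1" by (simp add: block_mult outer_zero)
    ultimately have gh: "Phi r (g ** h) = ?M ** ?N ** tilt (x /\<^sub>R r + y /\<^sub>R r)"
      using \<mu> \<nu> by (simp add: g h affine_mat_mult Phi_affine_mat orthogonal_matrix_mul scaleR_add_right)
    have N: "block (transpose \<nu>) 0 0 1 ** ?N = mat 1"
      using orthogonal_block_diag[OF \<nu>] by (simp add: orthogonal_matrix_def transpose_block)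
    have "transpose \<mu> *v b = \<nu> *v x"
      by (simp add: x_def matrix_vector_mul_assoc matrix_mul_assoc \<nu>'
        del: transpose_matrix_vector)
    then have "Phi r g = ?M ** (?N ** tilt (x /\<^sub>R r) ** block (transpose \<nu>) 0 0 1)"
      by (simp add: g Phi_affine_mat[OF \<mu>] tilt_conj[OF \<nu>] matrix_mult_vec_arith
          del: transpose_matrix_vector)
    moreover have "Phi r h = ?N ** tilt (y /\<^sub>R r)"
      by (simp add: h Phi_affine_mat[OF \<nu>] y_def)
    ultimately have "Phi r g ** Phi r h = ?M ** ?N ** tilt (x /\<^sub>R r) **
        (block (transpose \<nu>) 0 0 1 ** ?N) ** tilt (y /\<^sub>R r)"
      by (simp only: matrix_mul_assoc)
    also have "\<dots> = ?M ** ?N ** (tilt (x /\<^sub>R r) ** tilt (y /\<^sub>R r))"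
      unfolding N by (simp add: matrix_mul_assoc)
    finally have "Phi r g ** Phi r h = ?M ** ?N ** (tilt (x /\<^sub>R r) ** tilt (y /\<^sub>R r))" .
    then have "Phi r (g ** h) - Phi r g ** Phi r h =
        ?M ** ?N ** (tilt (x /\<^sub>R r + y /\<^sub>R r) - tilt (x /\<^sub>R r) ** tilt (y /\<^sub>R r))"
      by (simp add: gh matrix_mult_diff)
    then have "norm (Phi r (g ** h) - Phi r g ** Phi r h) \<le>
        norm (?M ** ?N) * norm (tilt (x /\<^sub>R r + y /\<^sub>R r) - tilt (x /\<^sub>R r) ** tilt (y /\<^sub>R r))"
      by (simp only: norm_matrix_mult_le)
    also have "\<dots> \<le> norm (?M ** ?N) * ((norm (x /\<^sub>R r + y /\<^sub>R r))\<^sup>2 + (norm (x /\<^sub>R r))\<^sup>2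
        + (norm (y /\<^sub>R r))\<^sup>2 + 4 * norm (x /\<^sub>R r) * norm (y /\<^sub>R r))"
      by (intro mult_left_mono norm_tilt_add_le) simp
    \<comment> \<open>All terms of the bound are homogeneous of degree 2 in \<open>(x, y)\<close>,
      which is where the rate \<open>1 / r\<^sup>2\<close> comes from.\<close>
    also have "\<dots> = norm (?M ** ?N) * K * \<bar>inverse r\<bar>\<^sup>2"
      unfolding scaleR_add_right[symmetric] norm_scaleR K_def
      by (simp only: power_mult_distrib power2_eq_square algebra_simps)
    also have "\<bar>inverse r\<bar>\<^sup>2 = norm (1 / r\<^sup>2)"
      by (simp add: power_inverse divide_inverse)
    finally show ?thesis .
  qed
  show ?thesis
    by (rule bigoI[where c = "norm (?M ** ?N) * K"], rule always_eventually)
      (use le in \<open>simp add: frobenius_norm_eq_norm\<close>)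
qed

theorem proposition3p4:
  shows "(\<forall>r\<ge>1. Phi r \<in> (SE :: (('d::finite) option) sqmat set) \<rightarrow> SO)
    \<and> (\<forall>g \<in> (SE :: ('d option) sqmat set). \<forall>r\<ge>1.
          Phi r (matrix_inv g) = matrix_inv (Phi r g))
    \<and> (\<forall>g\<^sub>1 \<in> (SE :: ('d option) sqmat set). \<forall>g\<^sub>2 \<in> SE.
          (\<lambda>r. frobenius_norm (Phi r (g\<^sub>1 ** g\<^sub>2) - Phi r g\<^sub>1 ** Phi r g\<^sub>2))
            \<in> O[at_top](\<lambda>r. 1 / r\<^sup>2))"
  using Phi_in_SO Phi_matrix_inv Phi_mult_bigo by blast

end
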